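(* Let $n \ge 2$, let $a_0,\dots,a_{n-1}\in\mathbb R$, and let $S$ be the set of all $X\in M_2(\mathbb R)$ such that $X^n+a_{n-1}\cdot X^{n-1}+\dots+a_1\cdot X+a_0\cdot I=O$. Then $\dim S=2$.
   Context: $M_2(\mathbb R)$ is the algebra of real $2\times2$ matrices with its Euclidean topology (homeomorphic to $\mathbb R^4$), $I$ is the identity matrix, $O$ the null matrix. $S$ carries the subspace topology and $\dim$ denotes the (Lebesgue) covering dimension. *)

theory Defs
  imports "HOL-Analysis.Analysis"
begin

(* The multiplication inherited by the type real^2^2 from the class of vectors is entrywise,
   so the power operation X ^ k of the type is not the power of the matrix X. *)
primrec mat_power :: "'a::semiring_1 ^ 'n ^ 'n \<Rightarrow> nat \<Rightarrow> 'a ^ 'n ^ 'n" where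
  "mat_power X 0 = mat 1"
| "mat_power X (Suc k) = X ** mat_power X k"

(* Lebesgue's condition dim X \<le> m: every finite open cover has a finite open refinement
   that covers X and in which no point lies in more than m + 1 members. The bound m is an
   integer because the bound -1, which holds exactly for the empty space, is allowed. This is not the
   small inductive dimension dim_le of the library. *)
definition covering_dim_le :: "'a topology \<Rightarrow> int \<Rightarrow> bool" where
  "covering_dim_le X m \<longleftrightarrow>
     (\<forall>\<U>. finite \<U> \<and> (\<forall>U\<in>\<U>. openin X U) \<and> \<Union>\<U> = topspace X \<longrightarrow>
       (\<exists>\<V>. finite \<V> \<and> (\<forall>V\<in>\<V>. openin X V) \<and> \<Union>\<V> = topspace X \<and>
            (\<forall>V\<in>\<V>. \<exists>U\<in>\<U>. V \<subseteq> U) \<and>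
            (\<forall>x\<in>topspace X. int (card {V\<in>\<V>. x \<in> V}) \<le> m + 1)))"

(* The value is -1 for the empty space, and \<infinity> (the infimum of the empty set) if no bound holds. *)
definition covering_dim :: "'a topology \<Rightarrow> ereal" where
  "covering_dim X = Inf {ereal (of_int m) | m. - 1 \<le> m \<and> covering_dim_le X m}"

end

theory Submission
  imports Defs "HOL-Computational_Algebra.Fundamental_Theorem_Algebra"
begin

text \<open>Let \<open>p\<close> be the given monic polynomial. A matrix \<open>X\<close> annihilated by \<open>p\<close> is a scalar matrix whose diagonal entry
is a root of \<open>p\<close>, or its characteristic polynomial divides \<open>p\<close> (\<open>mat_poly_0_cases\<close>). So trace and
determinant take only finitely many pairs of values on \<open>S\<close>, and conversely \<open>S\<close> contains, for every real monic
quadratic divisor \<open>u\<^sup>2 - t u + d\<close> of \<open>p\<close>, all matrices with trace \<open>t\<close> and determinant \<open>d\<close>. In suitable linear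
coordinates these form a quadric \<open>x\<^sup>2 + y\<^sup>2 - z\<^sup>2 = t\<^sup>2 - 4 d\<close>. Thus \<open>S\<close> is a finite union of points, cones and
hyperboloids, and at least one surface occurs as the degree of \<open>p\<close> is at least 2.

\<^item> Upper bound. The map \<open>(x, y)\<close> has finite fibres on the closed set \<open>S\<close>. The plane is a union of three sets of
the form \<open>{w. u w \<notin> \<rat> \<and> v w \<notin> \<rat>}\<close> with affine coordinates \<open>u\<close>, \<open>v\<close>, and by \<open>clopen_base_irrational_coordinates\<close> their
preimages in \<open>S\<close> have bases of clopen sets. A union of three such sets has covering dimension at most 2
(\<open>covering_dim_le_Union_clopen_base\<close>), since each of them contributes a disjoint family to a refinement.

\<^item> Lower bound. \<open>S\<close> retracts onto the graph of a continuous function over a triangle. A space with a triangle as a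
retract does not have covering dimension at most 1 (\<open>not_covering_dim_le_1\<close>); this is Lebesgue's covering
theorem, which is deduced from Brouwer's fixed point theorem.\<close>

section \<open>Bounds and values of the covering dimension\<close>

lemma covering_dim_le_mono:
  assumes "covering_dim_le X m" "m \<le> k"
  shows "covering_dim_le X k"
proof -
  have "int c \<le> m + 1 \<Longrightarrow> int c \<le> k + 1" for c using assms(2) by linarith
  then show ?thesis using assms(1) unfolding covering_dim_le_def by (smt (verit))
qed

lemma covering_dim_eqI:
  assumes "covering_dim_le X m" "\<not> covering_dim_le X (m - 1)" "0 \<le> m"
  shows "covering_dim X = ereal (of_int m)"
  unfolding covering_dim_def
proof (rule antisym)
  show "Inf {ereal (real_of_int k) |k. - 1 \<le> k \<and> covering_dim_le X k} \<le> ereal (real_of_int m)"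
    using assms(1,3) by (intro Inf_lower) auto
  show "ereal (real_of_int m) \<le> Inf {ereal (real_of_int k) |k. - 1 \<le> k \<and> covering_dim_le X k}"
  proof (rule Inf_greatest)
    fix e assume "e \<in> {ereal (real_of_int k) |k. - 1 \<le> k \<and> covering_dim_le X k}"
    then obtain k where k: "e = ereal (real_of_int k)" "covering_dim_le X k" by blast
    then have "\<not> k \<le> m - 1" using covering_dim_le_mono assms(2) by blast
    then show "ereal (real_of_int m) \<le> e" using k(1) by simp
  qed
qed

section \<open>Unions of zero-dimensional sets\<close>

text \<open>This is small inductive dimension at most 0. For separable metric spaces it coincides with covering
dimension at most 0, and it is the form that can be checked by drawing small boxes.\<close>

definition clopen_base :: "'a::metric_space set \<Rightarrow> bool" where
  "clopen_base Z \<longleftrightarrow> (\<forall>z\<in>Z. \<forall>\<epsilon>>0. \<exists>C. z \<in> C \<and> C \<subseteq> ball z \<epsilon> \<and>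
      openin (top_of_set Z) C \<and> closedin (top_of_set Z) C)"

text \<open>By the Lindelof property countably many clopen sets, each inside a member of the cover, already
cover \<open>Z\<close>. To a point is assigned the cover member of the first clopen set that contains it. The
points with a given first index form a clopen set, so the assignment is locally constant.\<close>

lemma clopen_base_locally_constant_choice:
  fixes Z :: "'a::{metric_space,second_countable_topology} set"
  assumes Z: "clopen_base Z" and op: "\<And>U. U \<in> \<U> \<Longrightarrow> openin (top_of_set S) U"
    and cov: "Z \<subseteq> \<Union>\<U>" and "Z \<subseteq> S"
  obtains c where "\<And>z. z \<in> Z \<Longrightarrow> c z \<in> \<U> \<and> z \<in> c z"
    and "\<And>z. z \<in> Z \<Longrightarrow> \<exists>r>0. \<forall>w\<in>Z. dist z w < r \<longrightarrow> c w = c z"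
proof -
  define \<F> where "\<F> = {C. openin (top_of_set Z) C \<and> closedin (top_of_set Z) C \<and> (\<exists>U\<in>\<U>. C \<subseteq> U)}"
  have covF: "\<Union>\<F> = Z"
  proof
    show "\<Union>\<F> \<subseteq> Z" by (auto simp: \<F>_def dest: openin_imp_subset)
    show "Z \<subseteq> \<Union>\<F>"
    proof
      fix z assume z: "z \<in> Z"
      then obtain U where U: "U \<in> \<U>" "z \<in> U" using cov by blast
      then obtain e where e: "e > 0" "ball z e \<inter> S \<subseteq> U"
        using op[of U] by (auto simp: openin_contains_ball)
      obtain C where "z \<in> C" "C \<subseteq> ball z e" "openin (top_of_set Z) C" "closedin (top_of_set Z) C"
        using Z z e(1) unfolding clopen_base_def by blast
      moreover have "C \<subseteq> S" using calculation(3) \<open>Z \<subseteq> S\<close> openin_imp_subset by blast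
      ultimately show "z \<in> \<Union>\<F>" using e U unfolding \<F>_def by blast
    qed
  qed
  obtain \<F>' where F': "\<F>' \<subseteq> \<F>" "countable \<F>'" "\<Union>\<F>' = Z"
    by (rule Lindelof_openin[of \<F> Z]) (auto simp: \<F>_def covF[unfolded \<F>_def])
  show thesis
  proof (cases "Z = {}")
    case True
    then show thesis using that by blast
  next
    case False
    then have "\<F>' \<noteq> {}" using F'(3) by blast
    then obtain C :: "nat \<Rightarrow> 'a set" where C: "range C = \<F>'"
      using F'(2) by (metis uncountable_def)
    have Cc: "openin (top_of_set Z) (C n)" "closedin (top_of_set Z) (C n)" "\<exists>U\<in>\<U>. C n \<subseteq> U" for n
      using C F'(1) unfolding \<F>_def by blast+
    then obtain V where V: "\<And>n. V n \<in> \<U> \<and> C n \<subseteq> V n" by metis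
    define N where "N z = (LEAST n. z \<in> C n)" for z
    have N: "z \<in> C (N z)" if "z \<in> Z" for z
    proof -
      have "\<exists>n. z \<in> C n" using that unfolding F'(3)[symmetric] C[symmetric] by simp
      then show ?thesis unfolding N_def by (rule LeastI_ex)
    qed
    show thesis
    proof (rule that[of "\<lambda>z. V (N z)"])
      show "V (N z) \<in> \<U> \<and> z \<in> V (N z)" if "z \<in> Z" for z using V N[OF that] by blast
      fix z assume z: "z \<in> Z"
      define D where "D = C (N z) - (\<Union>m<N z. C m)"
      have "closedin (top_of_set Z) (\<Union>m<N z. C m)"
        using Cc(2) by (intro closedin_Union) auto
      then have "openin (top_of_set Z) D"
        unfolding D_def by (intro openin_diff Cc)
      moreover have "z \<notin> C m" if "m < N z" for m using that unfolding N_def by (rule not_less_Least)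
      then have "z \<in> D" unfolding D_def using N[OF z] by simp
      ultimately obtain r where r: "r > 0" "ball z r \<inter> Z \<subseteq> D"
        by (auto simp: openin_contains_ball)
      have "N w = N z" if "w \<in> D" for w
        using that unfolding D_def N_def[of w]
        by (intro Least_equality) (auto simp flip: not_less)
      then show "\<exists>r>0. \<forall>w\<in>Z. dist z w < r \<longrightarrow> V (N w) = V (N z)"
        using r by (intro exI[of _ r]) (auto simp: subset_iff)
    qed
  qed
qed

text \<open>The relatively open level sets of the locally constant assignment are disjoint, but only inside \<open>Z\<close>.
They are thickened to disjoint open sets of the ambient space \<open>S\<close> by balls of half the radius on
which the assignment is constant: if two such balls meet, one of the two centres lies within the full
radius of the other.\<close>

lemma clopen_base_disjoint_shrinking:
  fixes Z :: "'a::{metric_space,second_countable_topology} set"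
  assumes Z: "clopen_base Z" and op: "\<And>U. U \<in> \<U> \<Longrightarrow> openin (top_of_set S) U"
    and cov: "Z \<subseteq> \<Union>\<U>" and "Z \<subseteq> S"
  obtains W where "\<And>U. U \<in> \<U> \<Longrightarrow> openin (top_of_set S) (W U)" "\<And>U. W U \<subseteq> U"
    "Z \<subseteq> (\<Union>U\<in>\<U>. W U)" "\<And>U U' x. x \<in> W U \<Longrightarrow> x \<in> W U' \<Longrightarrow> U = U'"
proof -
  obtain c where c: "\<And>z. z \<in> Z \<Longrightarrow> c z \<in> \<U> \<and> z \<in> c z"
    and "\<And>z. z \<in> Z \<Longrightarrow> \<exists>r>0. \<forall>w\<in>Z. dist z w < r \<longrightarrow> c w = c z"
    using clopen_base_locally_constant_choice[OF assms] by metis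
  then obtain r where r: "\<And>z. z \<in> Z \<Longrightarrow> r z > 0"
    and rc: "\<And>z w. z \<in> Z \<Longrightarrow> w \<in> Z \<Longrightarrow> dist z w < r z \<Longrightarrow> c w = c z"
    by metis
  define W where "W U = U \<inter> (\<Union>z\<in>{z\<in>Z. c z = U}. ball z (r z / 2))" for U
  show thesis
  proof (rule that[of W])
    show "openin (top_of_set S) (W U)" if "U \<in> \<U>" for U
      unfolding W_def by (intro openin_Int_open op that) blast
    show "W U \<subseteq> U" for U by (auto simp: W_def)
    show "Z \<subseteq> (\<Union>U\<in>\<U>. W U)"
    proof
      fix z assume z: "z \<in> Z"
      have "z \<in> ball z (r z / 2)" using r[OF z] by simp
      then have "z \<in> W (c z)" using c[OF z] z unfolding W_def by blast
      then show "z \<in> (\<Union>U\<in>\<U>. W U)" using c[OF z] by blast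
    qed
    show "U = U'" if W: "x \<in> W U" "x \<in> W U'" for U U' x
    proof -
      obtain z where z: "z \<in> Z" "c z = U" "dist z x < r z / 2" using W(1) by (auto simp: W_def)
      obtain z' where z': "z' \<in> Z" "c z' = U'" "dist z' x < r z' / 2" using W(2) by (auto simp: W_def)
      have "dist z z' < r z / 2 + r z' / 2"
        using z(3) z'(3) dist_triangle2[of z z' x] by linarith
      then have "dist z z' < r z \<or> dist z' z < r z'" by (auto simp: dist_commute)
      then show ?thesis using rc z z' by metis
    qed
  qed
qed

text \<open>The easy half of the decomposition theorem of dimension theory: each of the pieces \<open>Z i\<close> contributes a
disjoint family of open sets, hence at most one set through any point.\<close>

lemma covering_dim_le_Union_clopen_base:
  fixes S :: "'a::{metric_space,second_countable_topology} set"
  assumes "finite I" and base: "\<And>i. i \<in> I \<Longrightarrow> clopen_base (Z i)" and S: "S = (\<Union>i\<in>I. Z i)"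
  shows "covering_dim_le (top_of_set S) (int (card I) - 1)"
  unfolding covering_dim_le_def
proof (intro allI impI; elim conjE)
  fix \<U> :: "'a set set"
  assume fin: "finite \<U>" and op: "\<forall>U\<in>\<U>. openin (top_of_set S) U" and cov: "\<Union>\<U> = topspace (top_of_set S)"
  have "\<exists>W. (\<forall>U\<in>\<U>. openin (top_of_set S) (W U)) \<and> (\<forall>U. W U \<subseteq> U) \<and> Z i \<subseteq> (\<Union>U\<in>\<U>. W U) \<and>
        (\<forall>U U' x. x \<in> W U \<longrightarrow> x \<in> W U' \<longrightarrow> U = U')" if i: "i \<in> I" for i
    by (rule clopen_base_disjoint_shrinking[OF base[OF i], of \<U> S]) (use op cov S i in auto)
  then obtain W where W: "\<And>i. i \<in> I \<Longrightarrow> (\<forall>U\<in>\<U>. openin (top_of_set S) (W i U)) \<and> (\<forall>U. W i U \<subseteq> U)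
      \<and> Z i \<subseteq> (\<Union>U\<in>\<U>. W i U) \<and> (\<forall>U U' x. x \<in> W i U \<longrightarrow> x \<in> W i U' \<longrightarrow> U = U')"
    by metis
  have Wop: "openin (top_of_set S) (W i U)" if "i \<in> I" "U \<in> \<U>" for i U using W[OF that(1)] that(2) by simp
  have Wsub: "W i U \<subseteq> U" if "i \<in> I" for i U using W[OF that] by simp
  have Wcov: "Z i \<subseteq> (\<Union>U\<in>\<U>. W i U)" if "i \<in> I" for i using W[OF that] by simp
  have Wdisj: "U = U'" if "i \<in> I" "x \<in> W i U" "x \<in> W i U'" for i x U U'
    using W[OF that(1)] that(2,3) by simp
  define \<V> where "\<V> = (\<lambda>(i, U). W i U) ` (I \<times> \<U>)"
  show "\<exists>\<V>. finite \<V> \<and> (\<forall>V\<in>\<V>. openin (top_of_set S) V) \<and> \<Union>\<V> = topspace (top_of_set S) \<and>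
      (\<forall>V\<in>\<V>. \<exists>U\<in>\<U>. V \<subseteq> U) \<and>
      (\<forall>x\<in>topspace (top_of_set S). int (card {V\<in>\<V>. x \<in> V}) \<le> int (card I) - 1 + 1)"
  proof (intro exI[of _ \<V>] conjI ballI)
    show "finite \<V>" using \<open>finite I\<close> fin by (simp add: \<V>_def)
    show opV: "openin (top_of_set S) V" if "V \<in> \<V>" for V using that Wop by (auto simp: \<V>_def)
    show "\<Union>\<V> = topspace (top_of_set S)"
    proof
      show "\<Union>\<V> \<subseteq> topspace (top_of_set S)" using opV openin_subset by blast
      show "topspace (top_of_set S) \<subseteq> \<Union>\<V>"
      proof
        fix x assume "x \<in> topspace (top_of_set S)"
        then obtain i where "i \<in> I" "x \<in> Z i" using S by auto
        then show "x \<in> \<Union>\<V>" using Wcov[of i] unfolding \<V>_def by blast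
      qed
    qed
    show "\<exists>U\<in>\<U>. V \<subseteq> U" if V: "V \<in> \<V>" for V
    proof -
      obtain i U where iU: "V = W i U" "i \<in> I" "U \<in> \<U>" using V by (auto simp: \<V>_def)
      then show ?thesis using Wsub[OF iU(2)] by blast
    qed
    fix x
    have "{V\<in>\<V>. x \<in> V} \<subseteq> (\<lambda>i. W i (THE U. x \<in> W i U)) ` I"
    proof
      fix V assume "V \<in> {V\<in>\<V>. x \<in> V}"
      then obtain i U where iU: "i \<in> I" "V = W i U" "x \<in> W i U" by (auto simp: \<V>_def)
      then have "(THE U. x \<in> W i U) = U" using Wdisj[OF iU(1)] by (intro the_equality) auto
      then show "V \<in> (\<lambda>i. W i (THE U. x \<in> W i U)) ` I" using iU by force
    qed
    then have "card {V\<in>\<V>. x \<in> V} \<le> card I" by (meson surj_card_le \<open>finite I\<close>)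
    then show "int (card {V\<in>\<V>. x \<in> V}) \<le> int (card I) - 1 + 1" by simp
  qed
qed

text \<open>A small box with rational sides in the coordinates \<open>u\<close>, \<open>v\<close> has no point of the set on its boundary. The
preimage of the box in \<open>S\<close> need not be small, because \<open>(u, v)\<close> is not injective. But as fibres are finite,
some small sphere around \<open>w\<close> misses the fibre of \<open>w\<close>, and by compactness the preimage of a sufficiently
small box misses that sphere too. The part of the preimage inside the sphere is then clopen.\<close>

lemma clopen_base_irrational_coordinates:
  fixes S :: "'a::heine_borel set" and u v :: "'a \<Rightarrow> real"
  assumes "closed S" and u: "continuous_on S u" and v: "continuous_on S v"
    and fib: "\<And>w. w \<in> S \<Longrightarrow> finite {w'\<in>S. u w' = u w \<and> v w' = v w}"
  shows "clopen_base {w\<in>S. u w \<notin> \<rat> \<and> v w \<notin> \<rat>}" (is "clopen_base ?Z")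
  unfolding clopen_base_def
proof (intro ballI allI impI)
  fix w and \<epsilon> :: real assume w: "w \<in> ?Z" and "\<epsilon> > 0"
  define F where "F = {w'\<in>S. u w' = u w \<and> v w' = v w}"
  have "finite (dist w ` F)" using fib w by (simp add: F_def)
  then have "infinite ({0<..<\<epsilon>} - dist w ` F)"
    using infinite_Ioo[OF \<open>\<epsilon> > 0\<close>] by simp
  then obtain r where r: "0 < r" "r < \<epsilon>" "r \<notin> dist w ` F"
    by (metis Diff_iff finite.emptyI ex_in_conv greaterThanLessThan_iff)
  \<comment> \<open>\<open>m w'\<close> is positive on the sphere because \<open>r\<close> avoids the distances from \<open>w\<close> to its fibre.\<close>
  define m where "m w' = max \<bar>u w' - u w\<bar> \<bar>v w' - v w\<bar>" for w'
  define K where "K = S \<inter> sphere w r"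
  have "closed (sphere w r)"
    unfolding sphere_def by (intro closed_Collect_eq continuous_intros)
  then have "compact K"
    unfolding K_def compact_eq_bounded_closed using \<open>closed S\<close> bounded_subset[OF bounded_cball, of _ w r]
    by (auto simp: closed_Int)
  have cm: "continuous_on K m" unfolding m_def K_def
    by (intro continuous_intros continuous_on_subset[OF u] continuous_on_subset[OF v]) auto
  have mpos: "m w' > 0" if "w' \<in> K" for w'
    using that r(3) unfolding m_def K_def F_def by (auto simp: less_max_iff_disj)
  have "\<exists>\<delta>>0. \<forall>w'\<in>K. \<delta> \<le> m w'"
  proof (cases "K = {}")
    case False
    then show ?thesis
      using continuous_attains_inf[OF \<open>compact K\<close> _ cm] mpos by metis
  qed (auto intro: exI[of _ 1])
  then obtain \<delta> where \<delta>: "\<delta> > 0" "\<And>w'. w' \<in> K \<Longrightarrow> \<delta> \<le> m w'" by blast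
  obtain a b where a: "a \<in> \<rat>" "u w - \<delta> < a" "a < u w" and b: "b \<in> \<rat>" "u w < b" "b < u w + \<delta>"
    using Rats_dense_in_real[of "u w - \<delta>" "u w"] Rats_dense_in_real[of "u w" "u w + \<delta>"] \<delta>(1) by auto
  obtain a' b' where a': "a' \<in> \<rat>" "v w - \<delta> < a'" "a' < v w"
    and b': "b' \<in> \<rat>" "v w < b'" "b' < v w + \<delta>"
    using Rats_dense_in_real[of "v w - \<delta>" "v w"] Rats_dense_in_real[of "v w" "v w + \<delta>"] \<delta>(1) by auto
  define C where "C = {w'\<in>?Z. w' \<in> ball w r \<and> u w' \<in> {a<..<b} \<and> v w' \<in> {a'<..<b'}}"
  \<comment> \<open>Replacing strict by weak inequalities does not change the set, which makes it closed as well as open.\<close>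
  have C': "C = {w'\<in>?Z. w' \<in> cball w r \<and> u w' \<in> {a..b} \<and> v w' \<in> {a'..b'}}"
  proof
    show "C \<subseteq> {w'\<in>?Z. w' \<in> cball w r \<and> u w' \<in> {a..b} \<and> v w' \<in> {a'..b'}}" by (auto simp: C_def)
    show "{w'\<in>?Z. w' \<in> cball w r \<and> u w' \<in> {a..b} \<and> v w' \<in> {a'..b'}} \<subseteq> C"
    proof
      fix w' assume w': "w' \<in> {w'\<in>?Z. w' \<in> cball w r \<and> u w' \<in> {a..b} \<and> v w' \<in> {a'..b'}}"
      then have "m w' < \<delta>" using a b a' b' unfolding m_def by auto
      then have "w' \<notin> K" using \<delta>(2) by force
      then have "dist w w' < r" using w' unfolding K_def by auto
      moreover have "u w' \<noteq> a" "u w' \<noteq> b" "v w' \<noteq> a'" "v w' \<noteq> b'" using w' a b a' b' by auto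
      ultimately show "w' \<in> C" using w' unfolding C_def by auto
    qed
  qed
  have cZ: "continuous_on ?Z u" "continuous_on ?Z v"
    by (auto intro: continuous_on_subset[OF u] continuous_on_subset[OF v])
  have "C = ?Z \<inter> ball w r \<inter> (?Z \<inter> u -` {a<..<b}) \<inter> (?Z \<inter> v -` {a'<..<b'})"
    unfolding C_def by auto
  moreover have "openin (top_of_set ?Z) \<dots>"
    by (intro openin_Int continuous_openin_preimage_gen cZ openin_open_Int) auto
  ultimately have "openin (top_of_set ?Z) C" by simp
  moreover have "C = ?Z \<inter> cball w r \<inter> (?Z \<inter> u -` {a..b}) \<inter> (?Z \<inter> v -` {a'..b'})"
    unfolding C' by auto
  moreover have "closedin (top_of_set ?Z) \<dots>"
    by (intro closedin_Int continuous_closedin_preimage cZ closedin_closed_Int) auto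
  ultimately have "openin (top_of_set ?Z) C" "closedin (top_of_set ?Z) C" by simp_all
  moreover have "w \<in> C" "C \<subseteq> ball w \<epsilon>" using w r a b a' b' by (auto simp: C_def)
  ultimately show "\<exists>C. w \<in> C \<and> C \<subseteq> ball w \<epsilon> \<and> openin (top_of_set ?Z) C \<and> closedin (top_of_set ?Z) C"
    by blast
qed

text \<open>The usual decomposition of the plane according to the number of rational coordinates has a piece,
exactly one rational coordinate, for which the axis-parallel boxes do not give a clopen base. That piece
lies in the set where \<open>x + y\<close> and \<open>x - y\<close> are both irrational, and the points with two rational
coordinates lie in a translate, by an irrational \<open>c\<close>, of the set with none. So all three pieces are
sets of points with two irrational coordinates, for three different affine coordinate systems.\<close>

lemma covering_dim_le_2_finite_fibres:
  fixes S :: "'a::{heine_borel,second_countable_topology} set" and x y :: "'a \<Rightarrow> real"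
  assumes "closed S" and x: "continuous_on S x" and y: "continuous_on S y"
    and fib: "\<And>w. w \<in> S \<Longrightarrow> finite {w'\<in>S. x w' = x w \<and> y w' = y w}"
  shows "covering_dim_le (top_of_set S) 2"
proof -
  obtain c :: real where c: "c \<notin> \<rat>"
    using countable_rat uncountable_UNIV_real by (metis UNIV_eq_I)
  define u where "u i w = (if i = 0 then x w else if i = 1 then x w + y w else x w + c)" for i :: nat and w
  define v where "v i w = (if i = 0 then y w else if i = 1 then x w - y w else y w + c)" for i :: nat and w
  define Z where "Z i = {w\<in>S. u i w \<notin> \<rat> \<and> v i w \<notin> \<rat>}" for i
  have base: "clopen_base (Z i)" for i
    unfolding Z_def
  proof (rule clopen_base_irrational_coordinates[OF \<open>closed S\<close>])
    show "continuous_on S (u i)"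
      unfolding u_def by (cases "i = 0"; cases "i = 1") (simp_all add: continuous_on_add x y)
    show "continuous_on S (v i)"
      unfolding v_def by (cases "i = 0"; cases "i = 1") (simp_all add: continuous_on_add continuous_on_diff x y)
    show "finite {w'\<in>S. u i w' = u i w \<and> v i w' = v i w}" if "w \<in> S" for w
      by (rule finite_subset[OF _ fib[OF that]]) (auto simp: u_def v_def split: if_splits)
  qed
  have "w \<in> (\<Union>i\<in>{..<3}. Z i)" if w: "w \<in> S" for w
  proof -
    have "x w \<notin> \<rat> \<and> y w \<notin> \<rat> \<Longrightarrow> w \<in> Z 0" using w by (simp add: Z_def u_def v_def)
    moreover have "x w + y w \<notin> \<rat> \<and> x w - y w \<notin> \<rat>" if "(x w \<in> \<rat>) \<noteq> (y w \<in> \<rat>)"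
      using that Rats_diff[of "x w + y w" "x w"] Rats_diff[of "x w + y w" "y w"]
        Rats_diff[of "x w" "x w - y w"] Rats_add[of "x w - y w" "y w"] by auto
    then have "(x w \<in> \<rat>) \<noteq> (y w \<in> \<rat>) \<Longrightarrow> w \<in> Z 1" using w by (simp add: Z_def u_def v_def)
    moreover have "x w + c \<notin> \<rat> \<and> y w + c \<notin> \<rat>" if "x w \<in> \<rat>" "y w \<in> \<rat>"
      using that c Rats_diff[of "x w + c" "x w"] Rats_diff[of "y w + c" "y w"] by auto
    then have "x w \<in> \<rat> \<Longrightarrow> y w \<in> \<rat> \<Longrightarrow> w \<in> Z 2" using w by (simp add: Z_def u_def v_def)
    ultimately have "w \<in> Z 0 \<or> w \<in> Z 1 \<or> w \<in> Z 2" by blast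
    then show ?thesis by force
  qed
  then have "S = (\<Union>i\<in>{..<3::nat}. Z i)" by (auto simp: Z_def)
  then have "covering_dim_le (top_of_set S) (int (card {..<3::nat}) - 1)"
    by (intro covering_dim_le_Union_clopen_base[where Z = Z] base) auto
  then show ?thesis by simp
qed

section \<open>The covering theorem for the triangle\<close>

definition triangle :: "(real ^ 3) set" where
  "triangle = {x. (\<forall>i. 0 \<le> x $ i) \<and> (\<Sum>i\<in>UNIV. x $ i) = 1}"

lemma compact_triangle: "compact triangle"
proof -
  have "triangle \<subseteq> cbox 0 1"
  proof
    fix x assume x: "x \<in> triangle"
    have "x $ i \<le> 1" for i
      using x member_le_sum[of i UNIV "\<lambda>i. x $ i"] by (simp add: triangle_def)
    then show "x \<in> cbox 0 1" using x by (auto simp: triangle_def mem_box_cart)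
  qed
  moreover have "triangle = (\<Inter>i. {x. 0 \<le> x $ i}) \<inter> {x. (\<Sum>i\<in>UNIV. x $ i) = 1}"
    by (auto simp: triangle_def)
  moreover have "closed \<dots>"
    by (intro closed_Int closed_INT ballI closed_Collect_le closed_Collect_eq continuous_intros)
  ultimately show ?thesis
    by (metis bounded_cbox bounded_subset compact_eq_bounded_closed)
qed

lemma convex_triangle: "convex triangle"
  unfolding convex_def triangle_def
  by (auto simp: sum.distrib sum_distrib_left[symmetric])

lemma triangle_nonempty: "triangle \<noteq> {}"
proof -
  have "axis 1 1 \<in> triangle" by (auto simp: triangle_def axis_def)
  then show ?thesis by blast
qed

text \<open>Follow the map by the cyclic shift of the barycentric coordinates; by Brouwer the composite has a fixed
point \<open>x\<close>, so that \<open>x $ i = \<phi> x $ (i + 1)\<close>. Some coordinate of \<open>\<phi> x\<close>, hence of \<open>x\<close>, vanishes. If \<open>x $ (i + 1)\<close>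
vanishes then so does \<open>\<phi> x $ (i + 1)\<close>, as faces are preserved, and hence \<open>x $ i\<close>. Going round, all three
coordinates of \<open>x\<close> vanish, but they sum to 1. (The index type has three elements, with addition
modulo 3.)\<close>

lemma no_face_preserving_map_into_boundary:
  fixes \<phi> :: "real ^ 3 \<Rightarrow> real ^ 3"
  assumes "continuous_on triangle \<phi>" "\<phi> ` triangle \<subseteq> triangle"
    and face: "\<And>x i. x \<in> triangle \<Longrightarrow> x $ i = 0 \<Longrightarrow> \<phi> x $ i = 0"
    and bdry: "\<And>x. x \<in> triangle \<Longrightarrow> \<exists>i. \<phi> x $ i = 0"
  shows False
proof -
  define \<psi> :: "real ^ 3 \<Rightarrow> real ^ 3" where "\<psi> x = (\<chi> i. \<phi> x $ (i + 1))" for x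
  have "\<psi> x \<in> triangle" if "x \<in> triangle" for x
  proof -
    have "(\<Sum>i\<in>UNIV. \<phi> x $ (i + 1)) = (\<Sum>i\<in>UNIV. \<phi> x $ i)" 
      by (rule sum.reindex_bij_witness[of _ "\<lambda>i. i - 1" "\<lambda>i. i + 1"]) auto
    then show ?thesis using that assms(2) by (auto simp: \<psi>_def triangle_def)
  qed
  moreover have "continuous_on triangle \<psi>"
    unfolding \<psi>_def by (intro continuous_intros assms)
  ultimately obtain x where x: "x \<in> triangle" "\<psi> x = x"
    using brouwer[OF compact_triangle convex_triangle triangle_nonempty] by blast
  have shift: "x $ i = \<phi> x $ (i + 1)" for i using x(2) by (metis \<psi>_def vec_lambda_beta)
  have step: "x $ (i + 1) = 0 \<Longrightarrow> x $ i = 0" for i using shift face[OF x(1)] by metis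
  obtain j where "x $ j = 0" using bdry[OF x(1)] shift[of "_ - 1"] by (metis diff_add_cancel)
  then have "x $ 1 = 0 \<and> x $ 2 = 0 \<and> x $ 3 = 0"
  proof -
    have "(1::3) + 1 = 2" "(2::3) + 1 = 3" "(3::3) + 1 = 1" by simp_all
    then show ?thesis using step[of 1] step[of 2] step[of 3] exhaust_3[of j] \<open>x $ j = 0\<close> by metis
  qed
  then show False using x(1) by (simp add: triangle_def sum_3)
qed

text \<open>Lebesgue's covering argument for a space \<open>X\<close> that has the triangle as a retract. The cover consists of the
three sets where a barycentric coordinate is positive. The members of a refinement are grouped into
three open sets, one for each coordinate; if at most two members meet at any point then these three sets
have no common point. The normalised distances from their complements in the triangle form a map
of the triangle into its boundary that preserves faces, which is impossible.\<close>

lemma not_covering_dim_le_1: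
  assumes f: "continuous_map (top_of_set triangle) X f" and g: "continuous_map X (top_of_set triangle) g"
    and gf: "\<And>x. x \<in> triangle \<Longrightarrow> g (f x) = x"
  shows "\<not> covering_dim_le X 1"
proof
  assume dim: "covering_dim_le X 1"
  have fX: "f x \<in> topspace X" if "x \<in> triangle" for x using f that by (auto simp: continuous_map_def)
  have gT: "g s \<in> triangle" if "s \<in> topspace X" for s using g that by (auto simp: continuous_map_def)
  define U where "U i = {s \<in> topspace X. g s \<in> {x. x $ i > 0}}" for i :: 3
  have opU: "openin X (U i)" for i
    unfolding U_def
    by (intro openin_continuous_map_preimage[OF continuous_map_into_fulltopology[OF g]])
      (auto intro!: open_Collect_less continuous_intros)
  have covU: "\<Union>(range U) = topspace X"
  proof -
    have "s \<in> (\<Union>i. U i)" if s: "s \<in> topspace X" for s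
    proof (rule ccontr)
      assume "s \<notin> (\<Union>i. U i)"
      then have "g s $ i \<le> 0" for i using s by (auto simp: U_def not_less)
      then have "(\<Sum>i\<in>UNIV. g s $ i) \<le> 0" by (simp add: sum_nonpos)
      then show False using gT[OF s] by (simp add: triangle_def)
    qed
    then show ?thesis by (auto simp: U_def)
  qed
  obtain \<V> where fin: "finite \<V>" and opV: "\<And>V. V \<in> \<V> \<Longrightarrow> openin X V" and covV: "\<Union>\<V> = topspace X"
    and ref: "\<And>V. V \<in> \<V> \<Longrightarrow> \<exists>i. V \<subseteq> U i"
    and ord: "\<And>s. s \<in> topspace X \<Longrightarrow> int (card {V\<in>\<V>. s \<in> V}) \<le> 1 + 1"
  proof -
    have "finite (range U) \<and> (\<forall>V\<in>range U. openin X V) \<and> \<Union>(range U) = topspace X"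
      using opU covU by simp
    then show ?thesis
      using dim[unfolded covering_dim_le_def, THEN spec, of "range U"] that by (smt (verit) imageE)
  qed
  obtain \<iota> where \<iota>: "\<And>V. V \<in> \<V> \<Longrightarrow> V \<subseteq> U (\<iota> V)" using ref by metis
  define W where "W i = \<Union>{V\<in>\<V>. \<iota> V = i}" for i
  have ordW: "\<exists>i. s \<notin> W i" if s: "s \<in> topspace X" for s
  proof (rule ccontr)
    assume "\<not> (\<exists>i. s \<notin> W i)"
    then have "i \<in> \<iota> ` {V\<in>\<V>. s \<in> V}" for i unfolding W_def by (simp add: image_iff) metis
    then have "\<iota> ` {V\<in>\<V>. s \<in> V} = UNIV" by auto
    then have "CARD(3) \<le> card {V\<in>\<V>. s \<in> V}"
      using card_image_le[of "{V\<in>\<V>. s \<in> V}" \<iota>] fin by simp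
    then show False using ord[OF s] by simp
  qed
  define P where "P i = {x \<in> triangle. f x \<in> W i}" for i
  have opP: "openin (top_of_set triangle) (P i)" for i
  proof -
    have "openin X (W i)" unfolding W_def using opV by blast
    from openin_continuous_map_preimage[OF f this] show ?thesis by (simp add: P_def)
  qed
  have PU: "x $ i > 0" if "x \<in> P i" for x i
    using that \<iota> gf unfolding P_def W_def U_def by fastforce
  have covP: "\<exists>i. x \<in> P i" if x: "x \<in> triangle" for x
    using fX[OF x] covV x unfolding P_def W_def by blast
  \<comment> \<open>The complement of \<open>P i\<close> has to be non-empty, as the distance from the empty set is 0 by convention; it contains every vertex other than the one opposite to the \<open>i\<close>-th side.\<close>
  have PT: "P i \<subset> triangle" for i
  proof -
    have "axis (i + 1) 1 \<in> triangle" by (auto simp: triangle_def axis_def)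
    moreover have "axis (i + 1) 1 \<notin> P i"
      using PU[of "axis (i + 1) 1" i] exhaust_3[of i] by (auto simp: axis_def)
    ultimately show ?thesis by (auto simp: P_def)
  qed
  define d where "d i x = infdist x (triangle - P i)" for i x
  have d0: "d i x = 0 \<longleftrightarrow> x \<notin> P i" if "x \<in> triangle" for i x
  proof -
    have "closed (triangle - P i)"
      using closedin_diff[OF closedin_topspace opP[of i]] compact_triangle
      by (auto intro: closedin_closed_trans compact_imp_closed)
    then show ?thesis
      unfolding d_def using in_closed_iff_infdist_zero[of "triangle - P i" x] PT[of i] that by auto
  qed
  have dnn: "d i x \<ge> 0" for i x by (simp add: d_def infdist_nonneg)
  define D where "D x = (\<Sum>i\<in>UNIV. d i x)" for x
  have Dpos: "D x > 0" if x: "x \<in> triangle" for x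
  proof -
    obtain i where "x \<in> P i" using covP[OF x] by blast
    then have "d i x > 0" using d0[OF x, of i] dnn[of i x] by simp
    then show ?thesis unfolding D_def by (intro sum_pos2[of _ i]) (auto simp: dnn)
  qed
  define \<phi> :: "real ^ 3 \<Rightarrow> real ^ 3" where "\<phi> x = (\<chi> i. d i x / D x)" for x
  show False
  proof (rule no_face_preserving_map_into_boundary[of \<phi>])
    show "continuous_on triangle \<phi>"
      unfolding \<phi>_def using Dpos unfolding D_def d_def
      by (intro continuous_intros) (auto simp: less_le)
    show "\<phi> ` triangle \<subseteq> triangle"
    proof
      fix y assume "y \<in> \<phi> ` triangle"
      then obtain x where x: "x \<in> triangle" "y = \<phi> x" by blast
      have "(\<Sum>i\<in>UNIV. d i x / D x) = 1"
        using Dpos[OF x(1)] by (simp add: sum_divide_distrib[symmetric] D_def)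
      then show "y \<in> triangle"
        using Dpos[OF x(1)] dnn x(2) by (simp add: \<phi>_def triangle_def less_imp_le)
    qed
    fix x assume x: "x \<in> triangle"
    show "\<phi> x $ i = 0" if "x $ i = 0" for i
      using that d0[OF x, of i] PU[of x i] by (auto simp: \<phi>_def)
    show "\<exists>i. \<phi> x $ i = 0"
      using ordW[OF fX[OF x]] d0[OF x] by (auto simp: \<phi>_def P_def)
  qed
qed

section \<open>Real polynomials evaluated at matrices\<close>

lemma scaleR_matrix_mult_left: "(c *\<^sub>R A) ** B = c *\<^sub>R (A ** B)"
  for A :: "real ^ 'n ^ 'm"
  by (simp add: vec_eq_iff matrix_matrix_mult_def sum_distrib_left mult.assoc)

lemma scaleR_matrix_mult_right: "A ** (c *\<^sub>R B) = c *\<^sub>R (A ** B)"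
  for A :: "real ^ 'n ^ 'm"
  by (simp add: vec_eq_iff matrix_matrix_mult_def sum_distrib_left mult.left_commute)

lemma matrix_mult_add_left: "(A + B) ** C = A ** C + B ** C"
  for A :: "real ^ 'n ^ 'm"
  by (simp add: vec_eq_iff matrix_matrix_mult_def sum.distrib distrib_right)

lemma degree_less_2_eq_pCons:
  assumes "degree r < 2"
  shows "r = [:coeff r 0, coeff r 1:]"
proof (rule poly_eqI)
  show "coeff r k = coeff [:coeff r 0, coeff r 1:] k" for k
  proof (cases "k < 2")
    case True
    then show ?thesis by (auto simp: less_2_cases_iff)
  next
    case False
    then show ?thesis using assms by (simp add: coeff_eq_0)
  qed
qed

text \<open>Horner's scheme, as for the evaluation of polynomials in commutative rings, but with the matrix
product: the multiplication of the type of matrices is entrywise.\<close>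

definition mat_poly :: "real poly \<Rightarrow> real ^ 'n ^ 'n \<Rightarrow> real ^ 'n ^ 'n" where
  "mat_poly p X = fold_coeffs (\<lambda>c M. c *\<^sub>R mat 1 + X ** M) p 0"

lemma mat_poly_0 [simp]: "mat_poly 0 X = 0"
  by (simp add: mat_poly_def)

lemma mat_poly_pCons [simp]: "mat_poly (pCons c p) X = c *\<^sub>R mat 1 + X ** mat_poly p X"
  by (cases "c = 0 \<and> p = 0") (auto simp: mat_poly_def)

lemma mat_poly_add [simp]: "mat_poly (p + q) X = mat_poly p X + mat_poly q X"
proof (induction p arbitrary: q)
  case (pCons c p)
  then show ?case
    by (cases q) (simp add: scaleR_add_left matrix_add_ldistrib)
qed simp

lemma mat_poly_smult [simp]: "mat_poly (smult c p) X = c *\<^sub>R mat_poly p X"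
  by (induction p) (simp_all add: scaleR_add_right scaleR_matrix_mult_right)

lemma mat_poly_mult: "mat_poly (p * q) X = mat_poly p X ** mat_poly q X"
proof (induction p)
  case (pCons c p)
  then show ?case
    by (simp add: matrix_mult_add_left matrix_mul_assoc scaleR_matrix_mult_left)
qed simp

lemma mat_poly_monom [simp]: "mat_poly (monom c k) X = c *\<^sub>R mat_power X k"
  by (induction k) (simp_all add: monom_0 monom_Suc scaleR_matrix_mult_right)

lemma mat_poly_sum [simp]: "mat_poly (\<Sum>k\<in>A. f k) X = (\<Sum>k\<in>A. mat_poly (f k) X)"
  by (induction A rule: infinite_finite_induct) auto

lemma mat_poly_scalar: "mat_poly p (c *\<^sub>R mat 1) = poly p c *\<^sub>R mat 1"
  by (induction p) (simp_all add: scaleR_add_left scaleR_matrix_mult_left)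

definition charpoly2 :: "real ^ 2 ^ 2 \<Rightarrow> real poly" where
  "charpoly2 X = [:det X, - trace X, 1:]"

lemma degree_charpoly2: "degree (charpoly2 X) = 2"
  by (simp add: charpoly2_def)

lemma Cayley_Hamilton_2: "mat_poly (charpoly2 X) X = 0"
  by (simp add: charpoly2_def vec_eq_iff forall_2 matrix_matrix_mult_def sum_2 det_2 trace_def mat_def
      algebra_simps)

lemma charpoly2_dvd_imp_mat_poly_0: "charpoly2 X dvd p \<Longrightarrow> mat_poly p X = 0"
  by (auto elim!: dvdE simp: mat_poly_mult Cayley_Hamilton_2)

text \<open>The remainder of \<open>p\<close> modulo the characteristic polynomial of \<open>X\<close> has degree at most 1 and annihilates \<open>X\<close>. Either it
is zero, or \<open>X\<close> is a scalar matrix.\<close>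

lemma mat_poly_0_cases:
  assumes "mat_poly p X = 0"
  obtains "charpoly2 X dvd p" | c where "X = c *\<^sub>R mat 1" "poly p c = 0"
proof -
  define r where "r = p mod charpoly2 X"
  have "degree r < 2"
    using degree_mod_less'[of "charpoly2 X" p] degree_charpoly2[of X]
    by (cases "r = 0") (auto simp: r_def charpoly2_def)
  then obtain A B where r: "r = [:B, A:]"
    using degree_less_2_eq_pCons by blast
  have "p = p div charpoly2 X * charpoly2 X + r" by (simp add: r_def)
  moreover have "mat_poly (p div charpoly2 X * charpoly2 X) X = 0"
    by (intro charpoly2_dvd_imp_mat_poly_0) simp
  ultimately have "mat_poly r X = 0"
    using assms by (metis add_0 mat_poly_add)
  then have AB: "B *\<^sub>R mat 1 + A *\<^sub>R X = 0"
    by (simp add: r scaleR_matrix_mult_right)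
  show thesis
  proof (cases "A = 0")
    case True
    then have "B = 0" using AB by (simp add: vec_eq_iff forall_2 mat_def)
    then have "charpoly2 X dvd p" using True r unfolding r_def by (simp add: mod_eq_0_iff_dvd)
    then show thesis by (rule that(1))
  next
    case False
    then have X: "X = (- B / A) *\<^sub>R mat 1"
      using AB by (simp add: vec_eq_iff field_simps add_eq_0_iff)
    then have "poly p (- B / A) *\<^sub>R (mat 1 :: real ^ 2 ^ 2) = 0"
      using assms mat_poly_scalar by metis
    then show thesis using X by (intro that(2)) (auto simp: vec_eq_iff forall_2 mat_def)
  qed
qed

lemma map_poly_of_real_mult: "map_poly complex_of_real (p * q) = map_poly of_real p * map_poly of_real q"
  by (intro poly_eqI) (simp add: coeff_map_poly coeff_mult)

lemma map_poly_of_real_add: "map_poly complex_of_real (p + q) = map_poly of_real p + map_poly of_real q"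
  by (intro poly_eqI) (simp add: coeff_map_poly)

lemma poly_map_poly_of_real: "poly (map_poly complex_of_real p) (of_real x) = of_real (poly p x)"
  by (induction p) (simp_all add: map_poly_pCons)

text \<open>A monic quadratic divisor is determined by the sum and the product of its complex roots, which are
among the finitely many complex roots of \<open>p\<close>.\<close>

lemma finite_monic_quadratic_divisors:
  fixes p :: "real poly"
  assumes "p \<noteq> 0"
  shows "finite {(t, d). [:d, - t, 1:] dvd p}"
proof -
  define R where "R = {z. poly (map_poly complex_of_real p) z = 0}"
  have "finite R" unfolding R_def using assms by (intro poly_roots_finite) (simp add: map_poly_eq_0_iff)
  have "(t, d) \<in> (\<lambda>(z, w). (Re (z + w), Re (z * w))) ` (R \<times> R)" if dvd: "[:d, - t, 1:] dvd p" for t d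
  proof -
    define s where "s = csqrt (complex_of_real (t\<^sup>2 - 4 * d))"
    define z where "z = (of_real t + s) / 2"
    define w where "w = (of_real t - s) / 2"
    have s2: "s\<^sup>2 = of_real (t\<^sup>2 - 4 * d)" by (simp add: s_def)
    have zw: "z + w = of_real t" "z * w = of_real d"
      using s2 by (simp_all add: z_def w_def field_simps power2_eq_square)
    obtain q where q: "p = [:d, - t, 1:] * q" using dvd by (rule dvdE)
    have quad: "map_poly complex_of_real [:d, - t, 1:] = [:z * w, - (z + w), 1:]"
      by (simp add: zw map_poly_pCons)
    have "z \<in> R" "w \<in> R"
      unfolding R_def q map_poly_of_real_mult quad by (simp_all add: algebra_simps)
    moreover have "(t, d) = (Re (z + w), Re (z * w))" unfolding zw by simp
    ultimately show ?thesis by force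
  qed
  then have "{(t, d). [:d, - t, 1:] dvd p} \<subseteq> (\<lambda>(z, w). (Re (z + w), Re (z * w))) ` (R \<times> R)" by auto
  then show ?thesis by (rule finite_subset) (simp add: \<open>finite R\<close>)
qed

text \<open>A complex root \<open>z\<close> that is not real gives the quadratic divisor with roots \<open>z\<close> and its conjugate: the
remainder \<open>A z + B\<close> has real coefficients, so it vanishes at \<open>z\<close> only if \<open>A = B = 0\<close>.\<close>

lemma linear_or_quadratic_divisor:
  fixes p :: "real poly"
  assumes "degree p \<ge> 1"
  obtains c where "[:- c, 1:] dvd p" | t d where "[:d, - t, 1:] dvd p"
proof -
  have "\<not> constant (poly (map_poly complex_of_real p))"
    using assms by (simp add: constant_degree degree_map_poly)
  then obtain z where z: "poly (map_poly complex_of_real p) z = 0"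
    using fundamental_theorem_of_algebra by blast
  show thesis
  proof (cases "Im z = 0")
    case True
    then have "z = of_real (Re z)" by (simp add: complex_eq_iff)
    then have "poly p (Re z) = 0" using z poly_map_poly_of_real[of p "Re z"] by simp
    then show thesis using that(1) by (simp add: poly_eq_0_iff_dvd)
  next
    case False
    define q where "q = [:(Re z)\<^sup>2 + (Im z)\<^sup>2, - (2 * Re z), 1:]"
    define r where "r = p mod q"
    have "degree r < 2"
      using degree_mod_less'[of q p] by (cases "r = 0") (auto simp: r_def q_def)
    then obtain A B where r: "r = [:B, A:]"
      using degree_less_2_eq_pCons by blast
    have qz: "poly (map_poly complex_of_real q) z = 0"
      by (simp add: q_def map_poly_pCons complex_eq_iff power2_eq_square algebra_simps)
    have "p = p div q * q + r" by (simp add: r_def)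
    then have "map_poly complex_of_real p = map_poly of_real (p div q) * map_poly of_real q + map_poly of_real r"
      by (metis map_poly_of_real_mult map_poly_of_real_add)
    then have "of_real B + z * of_real A = 0"
      using z qz by (simp add: r map_poly_pCons)
    then have "A = 0 \<and> B = 0" using False by (auto simp: complex_eq_iff)
    then have "q dvd p" using r unfolding r_def by (simp add: mod_eq_0_iff_dvd)
    then show thesis unfolding q_def by (rule that(2))
  qed
qed

lemma monic_quadratic_divisor:
  fixes p :: "real poly"
  assumes "degree p \<ge> 2"
  obtains t d where "[:d, - t, 1:] dvd p"
proof (rule linear_or_quadratic_divisor[of p])
  show "degree p \<ge> 1" using assms by simp
  fix c assume "[:- c, 1:] dvd p"
  then obtain q where q: "p = [:- c, 1:] * q" by (rule dvdE)
  then have "q \<noteq> 0" using assms by auto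
  then have "degree q \<ge> 1" using assms unfolding q by (subst (asm) degree_mult_eq) auto
  then show thesis
  proof (rule linear_or_quadratic_divisor)
    fix b assume "[:- b, 1:] dvd q"
    then have "[:- c, 1:] * [:- b, 1:] dvd p" unfolding q by (intro mult_dvd_mono) auto
    then show thesis using that[of "c * b" "c + b"] by (simp add: algebra_simps)
  next
    fix t d assume "[:d, - t, 1:] dvd q"
    then show thesis using that[of d t] dvd_mult q by blast
  qed
qed (rule that)

section \<open>The zero set as a union of quadrics\<close>

lemma closed_zeros_mat_poly: "closed {X :: real ^ 'n ^ 'n. mat_poly p X = 0}"
proof -
  have "continuous_on UNIV (\<lambda>X :: real ^ 'n ^ 'n. mat_poly p X)"
    by (induction p) (auto intro!: continuous_intros simp: matrix_matrix_mult_def)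
  then show ?thesis by (intro closed_Collect_eq) auto
qed

text \<open>An annihilated matrix is either scalar, with a root of \<open>p\<close> on the diagonal, or has a characteristic
polynomial among the finitely many monic quadratic divisors of \<open>p\<close>.\<close>

lemma finite_trace_det_zeros_mat_poly:
  assumes "p \<noteq> 0"
  shows "finite ((\<lambda>X. (trace X, det X)) ` {X :: real ^ 2 ^ 2. mat_poly p X = 0})"
proof (rule finite_subset)
  show "(\<lambda>X. (trace X, det X)) ` {X :: real ^ 2 ^ 2. mat_poly p X = 0}
      \<subseteq> {(t, d). [:d, - t, 1:] dvd p} \<union> (\<lambda>c. (2 * c, c\<^sup>2)) ` {c. poly p c = 0}"
  proof (rule image_subsetI)
    fix X :: "real ^ 2 ^ 2" assume "X \<in> {X. mat_poly p X = 0}"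
    then have "mat_poly p X = 0" by simp
    then show "(trace X, det X) \<in> {(t, d). [:d, - t, 1:] dvd p} \<union> (\<lambda>c. (2 * c, c\<^sup>2)) ` {c. poly p c = 0}"
    proof (cases rule: mat_poly_0_cases)
      case 1
      then show ?thesis by (simp add: charpoly2_def)
    next
      case (2 c)
      then have "(trace X, det X) = (2 * c, c\<^sup>2)"
        by (simp add: trace_def sum_2 det_2 mat_def power2_eq_square)
      then show ?thesis using 2 by blast
    qed
  qed
  show "finite ({(t, d). [:d, - t, 1:] dvd p} \<union> (\<lambda>c. (2 * c, c\<^sup>2)) ` {c. poly p c = 0})"
    using assms by (simp add: finite_monic_quadratic_divisors poly_roots_finite)
qed

text \<open>Together with the trace these three functions are linear coordinates on the space of real 2 by 2 matrices:
they are twice the coordinates of the traceless part \<open>X - (trace X / 2) I\<close> with respect to the basis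
\<open>diag(1, -1)\<close>, the reflection in the diagonal, and the rotation by a quarter turn. They diagonalise the
discriminant of the characteristic polynomial.\<close>

definition traceless_x :: "real ^ 2 ^ 2 \<Rightarrow> real" where "traceless_x X = X $ 1 $ 1 - X $ 2 $ 2"
definition traceless_y :: "real ^ 2 ^ 2 \<Rightarrow> real" where "traceless_y X = X $ 1 $ 2 + X $ 2 $ 1"
definition traceless_z :: "real ^ 2 ^ 2 \<Rightarrow> real" where "traceless_z X = X $ 1 $ 2 - X $ 2 $ 1"

lemma discriminant_traceless:
  "(trace X)\<^sup>2 - 4 * det X = (traceless_x X)\<^sup>2 + (traceless_y X)\<^sup>2 - (traceless_z X)\<^sup>2"
  by (simp add: traceless_x_def traceless_y_def traceless_z_def trace_def sum_2 det_2
      power2_eq_square algebra_simps)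

lemma matrix_eq_traceless:
  assumes "trace X = trace Y" "traceless_x X = traceless_x Y" "traceless_y X = traceless_y Y"
    "traceless_z X = traceless_z Y"
  shows "X = Y"
  using assms unfolding traceless_x_def traceless_y_def traceless_z_def trace_def sum_2
  by (simp add: vec_eq_iff forall_2)

definition matrix_of_traceless :: "real \<Rightarrow> real \<Rightarrow> real \<Rightarrow> real \<Rightarrow> real ^ 2 ^ 2" where
  "matrix_of_traceless t x y z =
    (\<chi> i j. if i = 1 then (if j = 1 then t + x else y + z) / 2 else (if j = 1 then y - z else t - x) / 2)"

lemma matrix_of_traceless [simp]:
  "trace (matrix_of_traceless t x y z) = t" "traceless_x (matrix_of_traceless t x y z) = x"
  "traceless_y (matrix_of_traceless t x y z) = y" "traceless_z (matrix_of_traceless t x y z) = z"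
  by (simp_all add: matrix_of_traceless_def traceless_x_def traceless_y_def traceless_z_def trace_def sum_2
      field_simps)

text \<open>Trace and determinant fix the discriminant, and hence, given \<open>x\<close> and \<open>y\<close>, the square of the third
coordinate.\<close>

lemma finite_traceless_fibres:
  assumes fin: "finite ((\<lambda>X. (trace X, det X)) ` S)"
  shows "finite {X\<in>S. traceless_x X = x \<and> traceless_y X = y}" (is "finite ?F")
proof -
  define T where "T = (\<Union>(t, d) \<in> (\<lambda>X. (trace X, det X)) ` S. {t} \<times> {z. z\<^sup>2 = x\<^sup>2 + y\<^sup>2 - t\<^sup>2 + 4 * d})"
  have "finite {z::real. z\<^sup>2 = c}" for c
  proof (rule finite_subset)
    show "{z. z\<^sup>2 = c} \<subseteq> {sqrt c, - sqrt c}" by (auto simp: real_sqrt_abs abs_if split: if_splits)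
  qed simp
  then have "finite T" unfolding T_def by (intro finite_UN_I[OF fin]) (simp add: split_beta)
  moreover have "?F \<subseteq> (\<lambda>(t, z). matrix_of_traceless t x y z) ` T"
  proof
    fix X assume X: "X \<in> ?F"
    have "(trace X, traceless_z X) \<in> T"
      using X discriminant_traceless[of X] unfolding T_def by force
    moreover have "X = matrix_of_traceless (trace X) x y (traceless_z X)"
      using X by (intro matrix_eq_traceless) auto
    ultimately show "X \<in> (\<lambda>(t, z). matrix_of_traceless t x y z) ` T" by force
  qed
  ultimately show ?thesis by (meson finite_imageI finite_subset)
qed

lemma covering_dim_le_2_zeros_mat_poly:
  assumes "p \<noteq> 0"
  shows "covering_dim_le (top_of_set {X :: real ^ 2 ^ 2. mat_poly p X = 0}) 2"
proof (rule covering_dim_le_2_finite_fibres[OF closed_zeros_mat_poly])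
  show "continuous_on {X. mat_poly p X = 0} traceless_x" "continuous_on {X. mat_poly p X = 0} traceless_y"
    unfolding traceless_x_def traceless_y_def by (intro continuous_intros)+
qed (intro finite_traceless_fibres finite_trace_det_zeros_mat_poly assms)

text \<open>The quadric of all matrices with trace \<open>t\<close> and determinant \<open>d\<close> is \<open>x\<^sup>2 + y\<^sup>2 - z\<^sup>2 = c\<close> with \<open>c = t\<^sup>2 - 4 d\<close>. Over
a triangle in the half-plane \<open>x \<ge> R\<close>, with \<open>R\<^sup>2 \<ge> c\<close>, it contains the graph of \<open>z = sqrt (x\<^sup>2 + y\<^sup>2 - c)\<close>. The
retraction onto this graph is the projection to the \<open>(x, y)\<close>-plane in barycentric coordinates, followed by the
nearest point map of the triangle.\<close>

lemma not_covering_dim_le_1_zeros_mat_poly: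
  assumes "degree p \<ge> 2"
  shows "\<not> covering_dim_le (top_of_set {X :: real ^ 2 ^ 2. mat_poly p X = 0}) 1"
proof -
  obtain t d where dvd: "[:d, - t, 1:] dvd p" using monic_quadratic_divisor[OF assms] .
  define c where "c = t\<^sup>2 - 4 * d"
  define R where "R = \<bar>c\<bar> + 1"
  \<comment> \<open>The point of the plane with barycentric coordinates \<open>s\<close> is \<open>(R + s $ 2, s $ 3)\<close>; \<open>e\<close> inverts this affine map.\<close>
  define h where "h s = sqrt ((R + s $ 2)\<^sup>2 + (s $ 3)\<^sup>2 - c)" for s :: "real ^ 3"
  define f where "f s = matrix_of_traceless t (R + s $ 2) (s $ 3) (h s)" for s :: "real ^ 3"
  define e :: "real ^ 2 ^ 2 \<Rightarrow> real ^ 3" where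
    "e X = vector [1 - (traceless_x X - R) - traceless_y X, traceless_x X - R, traceless_y X]" for X
  have f0: "mat_poly p (f s) = 0" if s: "s \<in> triangle" for s
  proof -
    have "s $ 2 \<ge> 0" using s by (simp add: triangle_def)
    have "c \<le> R" "1 \<le> R" by (simp_all add: R_def)
    moreover have "R \<le> R\<^sup>2" using \<open>1 \<le> R\<close> by (simp add: self_le_power)
    moreover have "R\<^sup>2 \<le> (R + s $ 2)\<^sup>2"
      using \<open>s $ 2 \<ge> 0\<close> \<open>1 \<le> R\<close> by (intro power_mono) auto
    ultimately have "c \<le> (R + s $ 2)\<^sup>2" by linarith
    then have "(h s)\<^sup>2 = (R + s $ 2)\<^sup>2 + (s $ 3)\<^sup>2 - c"
      unfolding h_def by (intro real_sqrt_pow2) (simp add: add_increasing2)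
    then have "det (f s) = d"
      using discriminant_traceless[of "f s"] by (simp add: f_def c_def)
    then have "charpoly2 (f s) = [:d, - t, 1:]" by (simp add: charpoly2_def f_def)
    then show ?thesis using dvd charpoly2_dvd_imp_mat_poly_0 by metis
  qed
  have "continuous_on triangle h" unfolding h_def by (intro continuous_intros)
  then have "continuous_on triangle (\<lambda>s. (if i = 1 then (if j = 1 then t + (R + s $ 2) else s $ 3 + h s) / 2
      else (if j = 1 then s $ 3 - h s else t - (R + s $ 2)) / 2))" for i j :: 2
    by (cases "i = 1"; cases "j = 1"; simp; intro continuous_intros; simp)
  then have contf: "continuous_on triangle f"
    unfolding f_def matrix_of_traceless_def by (intro continuous_on_vec_lambda)
  have "continuous_on UNIV (\<lambda>X. e X $ i)" for i
    using exhaust_3[of i] unfolding e_def traceless_x_def traceless_y_def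
    by (elim disjE; simp add: vector_3; intro continuous_intros)
  then have "continuous_on UNIV e"
    using continuous_on_vec_lambda[of UNIV "\<lambda>i X. e X $ i"] by simp
  then have conte: "continuous_on A (\<lambda>X. closest_point triangle (e X))" for A
    using continuous_on_compose2[OF continuous_on_closest_point[OF convex_triangle
          compact_imp_closed[OF compact_triangle] triangle_nonempty], of UNIV]
    by (metis continuous_on_subset subset_UNIV)
  show ?thesis
  proof (rule not_covering_dim_le_1)
    show "continuous_map (top_of_set triangle) (top_of_set {X. mat_poly p X = 0}) f"
      using contf f0 by auto
    show "continuous_map (top_of_set {X. mat_poly p X = 0}) (top_of_set triangle) (\<lambda>X. closest_point triangle (e X))"
      using conte closest_point_in_set[OF compact_imp_closed[OF compact_triangle] triangle_nonempty] by auto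
    show "closest_point triangle (e (f s)) = s" if s: "s \<in> triangle" for s
    proof -
      have "e (f s) = s"
        using s by (simp add: e_def f_def vec_eq_iff forall_3 vector_3 triangle_def sum_3)
      then show ?thesis using s by (simp add: closest_point_self)
    qed
  qed
qed

theorem theorem4p5:
  fixes n :: nat and a :: "nat \<Rightarrow> real" and S :: "(real ^ 2 ^ 2) set"
  assumes "n \<ge> 2"
    and "S = {X. mat_power X n + (\<Sum>k<n. a k *\<^sub>R mat_power X k) = 0}"
  shows "covering_dim (top_of_set S) = 2"
proof -
  define p where "p = monom 1 n + (\<Sum>k<n. monom (a k) k)"
  have S: "S = {X. mat_poly p X = 0}" using assms(2) by (simp add: p_def)
  have "coeff p n = 1" by (simp add: p_def coeff_sum)
  then have "degree p \<ge> 2" using assms(1) le_degree[of p n] by simp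
  then have "p \<noteq> 0" by auto
  have "covering_dim (top_of_set S) = ereal (of_int 2)"
    unfolding S using covering_dim_le_2_zeros_mat_poly[OF \<open>p \<noteq> 0\<close>]
      not_covering_dim_le_1_zeros_mat_poly[OF \<open>degree p \<ge> 2\<close>] by (intro covering_dim_eqI) auto
  then show ?thesis by simp
qed

end
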